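(* Let $p>2$ be a prime, let $t$ be a positive divisor of $p-1$, let $k$ be an integer with $1<k\le (p/2)^{1/2}$, and let $a\in\mathbb{F}_p^*$. Put $r_1(k)=\left\lfloor \frac{\log(p/2)}{2\log k}\right\rfloor$ and $s=s_1(k,t)=\max\left\{s'\in\mathbb{Z}_{\ge0}~:~\binom{r_1(k)+s'}{s'}\le t\right\}$. Then $$\#\{|x|~:~x\in V(k,t,a)\}\le\tilde\Phi(k,s+1).$$
   Context: $\mathbb{F}_p$ is the field of residues modulo $p$. For $x\in\mathbb{F}_p$, the integer height is $|x|=\min\{|a|~:~a\in\mathbb{Z},\ a\equiv x\pmod p\}$ and the rational height is $\|x\|=\min\{\max(|a|,b)~:~a\in\mathbb{Z},\ b\in\mathbb{N},\ a\equiv bx \pmod p\}$. For $t\mid p-1$, $G$ is the unique subgroup of $\mathbb{F}_p^*$ of order $t$, $aG=\{ag:g\in G\}$, and $V(k,t,a)=\{x\in aG~:~\|x\|\le k\}$. $\Psi(x,y)$ is the number of positive integers $n\le x$ all of whose prime factors are at most $y$; $p_j$ is the $j$-th prime ($p_1=2$), with the convention $\Psi(x,p_0)=1$ for $x\ge 1$. For $s\in\mathbb{N}$, $\tilde\Phi(k,s)=\sum_{i=0}^{s}\binom{s}{i}\Psi(k,p_i)\Psi(k,p_{s-i})$, and $\tilde\Phi(k,0)=1$. *)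

theory Defs
  imports Complex_Main "HOL-Number_Theory.Residues" "HOL-Library.Infinite_Set"
begin

text \<open>
  The field of residues modulo \<open>p\<close> is \<open>residue_ring (int p)\<close>, with carrier \<open>{0..int p - 1}\<close>.
\<close>

abbreviation Fp :: "nat \<Rightarrow> int ring" where
  "Fp p \<equiv> residue_ring (int p)"

definition int_height :: "nat \<Rightarrow> int \<Rightarrow> nat" where
  "int_height p x = (LEAST n. \<exists>a::int. [a = x] (mod int p) \<and> n = nat \<bar>a\<bar>)"

text \<open>The denominator \<open>b\<close> is positive; admitting \<open>b = 0\<close> would make every height vanish.\<close>

definition rat_height :: "nat \<Rightarrow> int \<Rightarrow> nat" where
  "rat_height p x = (LEAST n. \<exists>(a::int) (b::nat). b > 0 \<and> [a = int b * x] (mod int p) \<and>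
     n = max (nat \<bar>a\<bar>) b)"

definition subgrp :: "nat \<Rightarrow> nat \<Rightarrow> int set" where
  "subgrp p t = (THE H. subgroup H (units_of (Fp p)) \<and> card H = t)"

lemma ex1_subgroup_of_order:
  assumes "prime p" "t dvd p - 1" "t > 0"
  shows "\<exists>!H. subgroup H (units_of (Fp p)) \<and> card H = t"
proof -
  interpret residues_prime p "Fp p"
    by unfold_locales (use assms in auto)
  let ?U = "units_of (Fp p)"
  interpret U: group ?U
    by (rule units_group)
  have cU: "carrier ?U = {1..int p - 1}"
    using res_prime_units_eq prime_gt_1_nat[OF assms(1)] by (simp add: units_of_def)
  have fU: "finite (carrier ?U)" by (simp add: cU)
  have oU: "order ?U = p - 1" by (simp add: order_def cU)
  have fR: "finite (carrier (Fp p))" by (rule finite)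
  let ?Z = "{x \<in> carrier (Fp p). x [^]\<^bsub>Fp p\<^esub> t = \<one>\<^bsub>Fp p\<^esub>}"
  have cZ: "card ?Z \<le> t" "finite ?Z"
    using num_roots_le_deg[OF fR, of t] assms(3) fR by auto
  have uniq: "H = ?Z" if H: "subgroup H ?U" "card H = t" for H
  proof -
    have sub: "H \<subseteq> carrier ?U" using H(1) by (rule subgroup.subset)
    interpret HG: group "?U\<lparr>carrier := H\<rparr>"
      using H(1) by (rule subgroup.subgroup_is_group) (rule units_group)
    have "H \<subseteq> ?Z"
    proof
      fix x assume x: "x \<in> H"
      have "x [^]\<^bsub>?U\<lparr>carrier := H\<rparr>\<^esub> order (?U\<lparr>carrier := H\<rparr>) = \<one>\<^bsub>?U\<lparr>carrier := H\<rparr>\<^esub>"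
        by (rule HG.pow_order_eq_1) (use x in simp)
      then have "x [^]\<^bsub>Fp p\<^esub> t = \<one>\<^bsub>Fp p\<^esub>"
        by (simp add: order_def H(2) units_of_def nat_pow_def)
      moreover have "x \<in> carrier (Fp p)"
        using sub x by (auto simp: units_of_def)
      ultimately show "x \<in> ?Z" by simp
    qed
    moreover have "card ?Z \<le> card H" using cZ H(2) by simp
    ultimately show ?thesis using card_seteq[OF cZ(2)] by blast
  qed
  obtain g where g: "g \<in> carrier (mult_of (Fp p))"
      "carrier (mult_of (Fp p)) = {g [^]\<^bsub>Fp p\<^esub> i | i::nat. i \<in> UNIV}"
    using finite_field_mult_group_has_gen[OF fR] by blast
  have g1: "g \<in> carrier ?U" using g(1) by (simp only: mult_of_is_Units)
  have g2: "carrier ?U = {g [^]\<^bsub>?U\<^esub> i | i::nat. i \<in> UNIV}"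
    using g(2) by (simp only: mult_of_is_Units[symmetric] nat_pow_mult_of)
  have "carrier ?U = (\<lambda>i. g [^]\<^bsub>?U\<^esub> i) ` {0..U.ord g - 1}"
    unfolding g2 using U.ord_elems[OF fU g1] by auto
  then have "card (carrier ?U) = card {0..U.ord g - 1}"
    using U.ord_inj[OF g1] card_image by metis
  then have og: "U.ord g = p - 1"
    using oU U.ord_ge_1[OF fU g1] by (simp add: order_def)
  define m where "m = (p - 1) div t"
  have p1: "p - 1 > 0" using prime_gt_1_nat[OF assms(1)] by simp
  have m: "m dvd p - 1" "m \<noteq> 0" "(p - 1) div m = t"
  proof -
    obtain c where c: "p - 1 = t * c" using assms(2) by (rule dvdE)
    then have "c \<noteq> 0" "m = c" using p1 assms(3) unfolding m_def by (auto intro: Nat.gr0I)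
    then show "m dvd p - 1" "m \<noteq> 0" "(p - 1) div m = t" using c by auto
  qed
  let ?h = "g [^]\<^bsub>?U\<^esub> m"
  have h: "?h \<in> carrier ?U" using g1 by simp
  have "U.ord ?h = t" using U.ord_pow[OF g1, of m] og m by simp
  then have "card (generate ?U {?h}) = t" using U.generate_pow_card[OF h] by simp
  moreover have "subgroup (generate ?U {?h}) ?U"
    by (rule U.generate_is_subgroup) (use h in simp)
  ultimately show ?thesis using uniq by blast
qed

definition V :: "nat \<Rightarrow> nat \<Rightarrow> nat \<Rightarrow> int \<Rightarrow> int set" where
  "V p k t a = {x \<in> a <#\<^bsub>Fp p\<^esub> subgrp p t. rat_height p x \<le> k}"

definition Psi :: "nat \<Rightarrow> nat \<Rightarrow> nat" where
  "Psi x y = card {n::nat. 0 < n \<and> n \<le> x \<and> (\<forall>q. prime q \<and> q dvd n \<longrightarrow> q \<le> y)}"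

text \<open>\<open>nth_prime 1 = 2\<close>; the value at \<open>0\<close> is not used.\<close>

definition nth_prime :: "nat \<Rightarrow> nat" where
  "nth_prime j = enumerate {q. prime q} (j - 1)"

text \<open>\<open>Psi_nth x j\<close> is \<open>\<Psi>(x, p\<^sub>j)\<close>, including the convention \<open>\<Psi>(x, p\<^sub>0) = 1\<close>.\<close>

definition Psi_nth :: "nat \<Rightarrow> nat \<Rightarrow> nat" where
  "Psi_nth x j = (if j = 0 then 1 else Psi x (nth_prime j))"

definition Phi_tilde :: "nat \<Rightarrow> nat \<Rightarrow> nat" where
  "Phi_tilde k s = (\<Sum>i=0..s. (s choose i) * Psi_nth k i * Psi_nth k (s - i))"

lemma Phi_tilde_0: "Phi_tilde k 0 = 1"
  by (simp add: Phi_tilde_def Psi_nth_def)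

definition r1 :: "nat \<Rightarrow> nat \<Rightarrow> nat" where
  "r1 p k = nat \<lfloor>ln (real p / 2) / (2 * ln (real k))\<rfloor>"

definition s1 :: "nat \<Rightarrow> nat \<Rightarrow> nat \<Rightarrow> nat" where
  "s1 p k t = Max {s. (r1 p k + s) choose s \<le> t}"

text \<open>In the range of parameters considered, the maximum defining \<open>s1\<close> is attained.\<close>

lemma r1_ge_1:
  assumes "1 < k" "real k \<le> sqrt (real p / 2)"
  shows "r1 p k \<ge> 1"
proof -
  have "real k ^ 2 \<le> sqrt (real p / 2) ^ 2"
    using assms by (intro power_mono) auto
  then have "real k ^ 2 \<le> real p / 2" by simp
  then have "ln (real k ^ 2) \<le> ln (real p / 2)"
    using assms(1) by (intro ln_mono) auto
  then have "1 \<le> ln (real p / 2) / (2 * ln (real k))"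
    using assms(1) by (simp add: ln_realpow)
  then have "1 \<le> \<lfloor>ln (real p / 2) / (2 * ln (real k))\<rfloor>" by linarith
  then show ?thesis unfolding r1_def by linarith
qed

lemma s1_set:
  assumes "1 < k" "real k \<le> sqrt (real p / 2)" "0 < t"
  shows "finite {s. (r1 p k + s) choose s \<le> t}" "0 \<in> {s. (r1 p k + s) choose s \<le> t}"
proof -
  have "s \<le> t" if "(r1 p k + s) choose s \<le> t" for s
  proof -
    have "(1 + s) choose s \<le> (r1 p k + s) choose s"
      using r1_ge_1[OF assms(1,2)] by (intro binomial_right_mono) simp
    then show ?thesis using that by simp
  qed
  then have "{s. (r1 p k + s) choose s \<le> t} \<subseteq> {..t}" by blast
  then show "finite {s. (r1 p k + s) choose s \<le> t}"
    by (rule finite_subset) (rule finite_atMost)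
  show "0 \<in> {s. (r1 p k + s) choose s \<le> t}" using assms(3) by simp
qed

end

theory Submission
  imports Defs "HOL-Library.Function_Algebras"
begin

text \<open>
  Up to sign, an element of \<open>V p k t a\<close> is the residue of a reduced positive fraction \<open>u/v\<close> with
  \<open>u, v \<le> k\<close>; attach to it the vector of exponents in its prime factorization. If \<open>s + 2\<close> of these
  vectors were linearly independent, all the products of \<open>r\<close> of the corresponding fractions would be
  different rational numbers with numerator and denominator at most \<open>k ^ r\<close>. As \<open>2 * k ^ (2 * r) < p\<close>,
  they would give different elements of one coset of the subgroup of order \<open>t\<close>, whence
  \<open>(r + s + 1) choose (s + 1) \<le> t\<close>, against the choice of \<open>s\<close>. So the vectors span a space of dimension
  at most \<open>s + 1\<close>, and some \<open>s + 1\<close> primes determine the fraction. Each of these primes divides at most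
  one of \<open>u\<close> and \<open>v\<close>; summing over the possible distributions of the primes gives \<open>Phi_tilde k (s + 1)\<close>.
\<close>

section \<open>Independence and separating coordinates in spaces of functions\<close>

interpretation fun_space: vector_space "\<lambda>(c::'a::field) (f::'i \<Rightarrow> 'a) x. c * f x"
  by unfold_locales (auto simp: fun_eq_iff algebra_simps)

lemma sum_fun_apply: "(\<Sum>i\<in>A. f i) x = (\<Sum>i\<in>A. f i x)"
  for f :: "'b \<Rightarrow> 'i \<Rightarrow> 'a::comm_monoid_add"
  by (induction A rule: infinite_finite_induct) auto

text \<open>Independence belongs to the image set, which forgets repetitions; \<open>inj\<close>
  lets the difference of the coefficients be read as one function on that set, and the vanishing
  combination forces it to be zero.\<close>

lemma fun_space_independent_coeffs_eq:
  fixes E :: "nat \<Rightarrow> 'i \<Rightarrow> 'a::field" and c d :: "nat \<Rightarrow> 'a"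
  assumes ind: "fun_space.independent (E ` {..<m})" and inj: "inj_on E {..<m}"
    and eq: "\<And>q. (\<Sum>i<m. c i * E i q) = (\<Sum>i<m. d i * E i q)"
    and i: "i < m"
  shows "c i = d i"
proof -
  define u where "u f = (let j = the_inv_into {..<m} E f in c j - d j)" for f
  have u: "u (E j) = c j - d j" if "j < m" for j
    using that by (simp add: u_def the_inv_into_f_f[OF inj] Let_def)
  have "(\<Sum>f\<in>E ` {..<m}. (\<lambda>x. u f * f x)) = (\<Sum>j<m. (\<lambda>x. u (E j) * E j x))"
    using inj by (simp add: sum.reindex)
  also have "\<dots> = 0"
    using eq by (auto simp: fun_eq_iff sum_fun_apply u algebra_simps sum_subtractf)
  finally have "u (E i) = 0"
    using ind i fun_space.dependent_finite[of "E ` {..<m}"] by blast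
  then show ?thesis using u[OF i] by simp
qed

text \<open>Induction on \<open>B\<close>: a new vector raises the dimension of the span by at most
  one, so at most one more coordinate is needed to tell its elements apart. That each coordinate in
  \<open>P\<close> is nonzero on some vector of the span is what later makes it a prime.\<close>

lemma fun_space_separating_coordinates:
  fixes B :: "('i \<Rightarrow> 'a::field) set"
  assumes "finite B"
  shows "\<exists>P. finite P \<and> card P \<le> card B \<and> (\<forall>q\<in>P. \<exists>f\<in>fun_space.span B. f q \<noteq> 0) \<and>
    (\<forall>f\<in>fun_space.span B. (\<forall>q\<in>P. f q = 0) \<longrightarrow> f = 0)"
  using assms
proof (induction B)
  case empty
  then show ?case by (intro exI[of _ "{}"]) auto
next
  case (insert w B)
  let ?S = "fun_space.span B" and ?T = "fun_space.span (insert w B)"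
  have ST: "?S \<subseteq> ?T" by (rule fun_space.span_mono) auto
  obtain P where P: "finite P" "card P \<le> card B" "\<forall>q\<in>P. \<exists>f\<in>?S. f q \<noteq> 0"
    and ker: "\<And>f. f \<in> ?S \<Longrightarrow> \<forall>q\<in>P. f q = 0 \<Longrightarrow> f = 0"
    using insert.IH by blast
  show ?case
  proof (cases "\<forall>f\<in>?T. (\<forall>q\<in>P. f q = 0) \<longrightarrow> f = 0")
    case True
    moreover have "card P \<le> card (insert w B)" using P(2) insert.hyps by simp
    ultimately show ?thesis using P ST by (intro exI[of _ P]) blast
  next
    case False
    then obtain f where f: "f \<in> ?T" "\<forall>q\<in>P. f q = 0" "f \<noteq> 0" by blast
    then obtain r where r: "f r \<noteq> 0" by (auto simp: fun_eq_iff)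
    obtain c where c: "f - (\<lambda>x. c * w x) \<in> ?S"
      using f(1) by (auto simp: fun_space.span_breakdown_eq)
    \<comment> \<open>The vectors of the span vanishing on \<open>P\<close> are the multiples of \<open>f\<close>.\<close>
    have "g = 0" if g: "g \<in> ?T" "\<forall>q\<in>insert r P. g q = 0" for g
    proof -
      obtain d where d: "g - (\<lambda>x. d * w x) \<in> ?S"
        using g(1) by (auto simp: fun_space.span_breakdown_eq)
      \<comment> \<open>The multiples of \<open>w\<close> cancel, so this combination lies in the
        old span, where \<open>P\<close> separates.\<close>
      have "(\<lambda>x. c * (g - (\<lambda>x. d * w x)) x) - (\<lambda>x. d * (f - (\<lambda>x. c * w x)) x) \<in> ?S"
        by (intro fun_space.span_diff fun_space.span_scale c d)
      also have "(\<lambda>x. c * (g - (\<lambda>x. d * w x)) x) - (\<lambda>x. d * (f - (\<lambda>x. c * w x)) x)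
          = (\<lambda>x. c * g x - d * f x)"
        by (auto simp: fun_eq_iff algebra_simps)
      finally have "(\<lambda>x. c * g x - d * f x) = 0"
        by (rule ker) (use g f in auto)
      then have lin: "c * g x = d * f x" for x by (auto simp: fun_eq_iff)
      have "d = 0" using lin[of r] g r by auto
      then have "g \<in> ?S" using d by (simp add: zero_fun_def[symmetric])
      then show "g = 0" using ker g by blast
    qed
    moreover have "card (insert r P) \<le> card (insert w B)"
      using P(1,2) insert.hyps by (simp add: card_insert_if)
    ultimately show ?thesis
      using P f(1) r ST by (intro exI[of _ "insert r P"]) blast
  qed
qed

section \<open>Integers supported on a finite set of primes\<close>

definition prime_part :: "nat set \<Rightarrow> nat \<Rightarrow> nat" where
  "prime_part P n = (\<Prod>q\<in>P. q ^ multiplicity q n)"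

lemma multiplicity_prime_part:
  assumes "finite P" "\<forall>q\<in>P. prime q" "prime q"
  shows "multiplicity q (prime_part P n) = (if q \<in> P then multiplicity q n else 0)"
  unfolding prime_part_def using assms by (subst multiplicity_prod_prime_powers) auto

lemma prime_part_pos: "finite P \<Longrightarrow> \<forall>q\<in>P. prime q \<Longrightarrow> prime_part P n > 0"
  unfolding prime_part_def by (intro prod_pos) (auto simp: prime_gt_0_nat)

lemma prime_part_le:
  assumes "finite P" "\<forall>q\<in>P. prime q" "n > 0"
  shows "prime_part P n \<le> n"
proof (rule dvd_imp_le)
  show "prime_part P n dvd n"
    using assms prime_part_pos[OF assms(1,2), of n]
    by (intro multiplicity_le_imp_dvd) (auto simp: multiplicity_prime_part)
qed (use assms in auto)

text \<open>The set counted by \<open>Psi\<close>, with the bound on prime factors replaced by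
  membership in an arbitrary set.\<close>

definition supported_upto :: "nat \<Rightarrow> nat set \<Rightarrow> nat set" where
  "supported_upto k I = {n. 0 < n \<and> n \<le> k \<and> (\<forall>q. prime q \<and> q dvd n \<longrightarrow> q \<in> I)}"

lemma finite_supported_upto: "finite (supported_upto k I)"
  by (rule finite_subset[of _ "{..k}"]) (auto simp: supported_upto_def)

lemma supported_upto_eq_prime_part:
  assumes "finite I" "\<forall>q\<in>I. prime q" "n \<in> supported_upto k I"
  shows "n = prime_part I n"
proof (rule multiplicity_eq_nat)
  fix q :: nat assume "prime q"
  then show "multiplicity q n = multiplicity q (prime_part I n)"
    using assms not_dvd_imp_multiplicity_0[of q n] by (auto simp: multiplicity_prime_part supported_upto_def)
qed (use assms prime_part_pos in \<open>auto simp: supported_upto_def\<close>)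

text \<open>Replacing the \<open>j\<close>-th smallest element of \<open>I\<close> by the \<open>j\<close>-th prime does not increase an
  integer supported on \<open>I\<close>.\<close>

lemma card_supported_upto_le:
  assumes "finite I" "\<forall>q\<in>I. prime q"
  shows "card (supported_upto k I) \<le> Psi_nth k (card I)"
proof (cases "I = {}")
  case True
  have "supported_upto k I \<subseteq> {1}"
  proof
    fix n assume "n \<in> supported_upto k I"
    then have "\<nexists>q. prime q \<and> q dvd n" using True by (auto simp: supported_upto_def)
    then show "n \<in> {1}" using prime_factor_nat[of n] by blast
  qed
  then have "card (supported_upto k I) \<le> card {1::nat}" by (intro card_mono) auto
  then show ?thesis using True by (simp add: Psi_nth_def)
next
  case False
  \<comment> \<open>Ranks and the enumeration \<open>pr\<close> both start at 0, so the smallest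
    element of \<open>I\<close> is sent to 2.\<close>
  define pr where "pr = enumerate {q::nat. prime q}"
  define rk where "rk q = card {q'\<in>I. q' < q}" for q
  define \<phi> where "\<phi> q = pr (rk q)" for q
  have pr_prime: "prime (pr j)" for j
    unfolding pr_def using enumerate_in_set[OF primes_infinite] by simp
  have pr_mono: "pr i \<le> pr j \<longleftrightarrow> i \<le> j" for i j
    unfolding pr_def using primes_infinite by simp
  have pr_less: "pr i < pr j \<longleftrightarrow> i < j" for i j
    unfolding pr_def using primes_infinite by simp
  have rk_less: "rk q < rk q'" if "q \<in> I" "q < q'" for q q'
    unfolding rk_def using that assms(1) by (intro psubset_card_mono) auto
  have inj: "inj_on \<phi> I"
  proof (rule inj_onI)
    fix x y assume "x \<in> I" "y \<in> I" "\<phi> x = \<phi> y"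
    moreover from this have "rk x = rk y"
      unfolding \<phi>_def by (metis pr_mono order_antisym order_refl)
    ultimately show "x = y" using rk_less by (metis less_irrefl linorder_neqE_nat)
  qed
  have \<phi>_le: "\<phi> q \<le> q" if q: "q \<in> I" for q
  proof -
    obtain j where j: "pr j = q"
      using enumerate_Ex[OF primes_infinite, of q] assms(2) q unfolding pr_def by blast
    \<comment> \<open>The elements of \<open>I\<close> below \<open>pr j\<close> are among the first
      \<open>j\<close> primes, so the rank of \<open>q\<close> is at most \<open>j\<close>.\<close>
    have "{q'\<in>I. q' < q} \<subseteq> pr ` {..<j}"
    proof
      fix x assume x: "x \<in> {q'\<in>I. q' < q}"
      then obtain i where "pr i = x"
        using enumerate_Ex[OF primes_infinite, of x] assms(2) unfolding pr_def by blast
      then show "x \<in> pr ` {..<j}" using x j pr_less by auto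
    qed
    then have "rk q \<le> card (pr ` {..<j})" unfolding rk_def by (intro card_mono) auto
    also have "\<dots> \<le> j" using card_image_le[of "{..<j}" pr] by simp
    finally show ?thesis unfolding \<phi>_def using j pr_mono by metis
  qed
  \<comment> \<open>\<open>nth_prime\<close> counts from 1, so the largest possible rank,
    \<open>card I - 1\<close>, corresponds to \<open>nth_prime (card I)\<close>.\<close>
  have rk_bound: "rk q \<le> card I - 1" if "q \<in> I" for q
  proof -
    have "rk q < card I"
      unfolding rk_def using that assms(1) by (intro psubset_card_mono) auto
    then show ?thesis by simp
  qed
  have \<phi>_prime: "prime (\<phi> q)" for q by (simp add: \<phi>_def pr_prime)
  define F where "F n = (\<Prod>q\<in>I. \<phi> q ^ multiplicity q n)" for n
  have F_alt: "F n = (\<Prod>r\<in>\<phi> ` I. r ^ multiplicity (the_inv_into I \<phi> r) n)" for n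
    unfolding F_def using inj by (simp add: prod.reindex the_inv_into_f_f)
  have mult_F: "multiplicity r (F n) = (if r \<in> \<phi> ` I then multiplicity (the_inv_into I \<phi> r) n else 0)"
    if "prime r" for r n
    unfolding F_alt using assms(1) \<phi>_prime that by (subst multiplicity_prod_prime_powers) auto
  have F_pos: "F n > 0" for n
    unfolding F_def by (intro prod_pos) (auto simp: prime_gt_0_nat \<phi>_prime)
  let ?T = "{n::nat. 0 < n \<and> n \<le> k \<and> (\<forall>q. prime q \<and> q dvd n \<longrightarrow> q \<le> nth_prime (card I))}"
  have "card (supported_upto k I) \<le> card ?T"
  proof (rule card_inj_on_le)
    show "inj_on F (supported_upto k I)"
    proof (rule inj_onI)
      fix x y assume xy: "x \<in> supported_upto k I" "y \<in> supported_upto k I" "F x = F y"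
      have "multiplicity q x = multiplicity q y" if "q \<in> I" for q
        using mult_F[OF \<phi>_prime[of q], of x] mult_F[OF \<phi>_prime[of q], of y] that xy(3)
        by (simp add: the_inv_into_f_f[OF inj])
      then have "prime_part I x = prime_part I y" by (simp add: prime_part_def)
      then show "x = y" using supported_upto_eq_prime_part[OF assms] xy by metis
    qed
    show "F ` supported_upto k I \<subseteq> ?T"
    proof safe
      fix n assume n: "n \<in> supported_upto k I"
      show "0 < F n" by (rule F_pos)
      have "F n \<le> prime_part I n"
        unfolding F_def prime_part_def by (intro prod_mono) (auto intro: power_mono \<phi>_le)
      then show "F n \<le> k"
        using supported_upto_eq_prime_part[OF assms n] n by (auto simp: supported_upto_def)
      fix r assume r: "prime r" "r dvd F n"
      then have "multiplicity r (F n) \<noteq> 0"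
        using F_pos[of n] by (simp add: prime_elem_multiplicity_eq_zero_iff)
      then obtain q where "q \<in> I" "r = \<phi> q" using mult_F[OF r(1), of n] by (auto split: if_splits)
      then show "r \<le> nth_prime (card I)"
        using rk_bound[of q] pr_mono by (simp add: \<phi>_def nth_prime_def pr_def)
    qed
    show "finite ?T" by (rule finite_subset[of _ "{..k}"]) auto
  qed
  then show ?thesis using False assms(1) by (simp add: Psi_nth_def Psi_def)
qed

section \<open>Counting reduced fractions by their exponents\<close>

text \<open>Grouping the subsets by size turns a sum over distributions of the primes into the
  binomial sum of \<open>Phi_tilde\<close>.\<close>

lemma sum_Pow_card:
  fixes g :: "nat \<Rightarrow> nat"
  assumes "finite P"
  shows "(\<Sum>I\<in>Pow P. g (card I)) = (\<Sum>i=0..card P. (card P choose i) * g i)"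
proof -
  have "(\<Sum>I\<in>Pow P. g (card I)) = (\<Sum>i\<in>{0..card P}. \<Sum>I\<in>{I\<in>Pow P. card I = i}. g (card I))"
    using assms by (intro sum.group[symmetric]) (auto intro: card_mono)
  also have "\<dots> = (\<Sum>i=0..card P. (card P choose i) * g i)"
    using assms by (intro sum.cong refl) (simp add: n_subsets)
  finally show ?thesis .
qed

text \<open>The valuations of the rational number \<open>fst w / snd w\<close>. The value 0 off the
  primes ensures that a coordinate where some vector is nonzero is a prime.\<close>

definition exponents :: "nat \<times> nat \<Rightarrow> nat \<Rightarrow> rat" where
  "exponents w q = (if prime q then of_nat (multiplicity q (fst w)) - of_nat (multiplicity q (snd w)) else 0)"

text \<open>Equal valuations give \<open>u * v' = u' * v\<close> by unique factorization, and
  reduced fractions with equal cross products coincide.\<close>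

lemma exponents_inj:
  assumes "u > 0" "v > 0" "coprime u v" "u' > 0" "v' > 0" "coprime u' v'"
    and "exponents (u, v) = exponents (u', v')"
  shows "(u, v) = (u', v')"
proof -
  have "u * v' = u' * v"
  proof (rule multiplicity_eq_nat)
    fix q :: nat assume q: "prime q"
    have "exponents (u, v) q = exponents (u', v') q" using assms by simp
    then have "of_nat (multiplicity q u + multiplicity q v') = (of_nat (multiplicity q u' + multiplicity q v) :: rat)"
      using q by (simp add: exponents_def)
    then have "multiplicity q u + multiplicity q v' = multiplicity q u' + multiplicity q v"
      by (simp only: of_nat_eq_iff)
    then show "multiplicity q (u * v') = multiplicity q (u' * v)"
      using q assms by (simp add: prime_elem_multiplicity_mult_distrib)
  qed (use assms in auto)
  then show ?thesis
    using assms coprime_crossproduct_nat[of u v u' v'] by (simp add: mult.commute)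
qed

text \<open>If \<open>P\<close> separates the exponent vectors, a reduced fraction \<open>u/v\<close> in \<open>W\<close> is determined by its
  \<open>P\<close>-part, whose numerator and denominator are supported on complementary subsets of \<open>P\<close>.\<close>

lemma card_le_Phi_tilde_if_separated:
  assumes P: "finite P" "\<forall>q\<in>P. prime q"
    and W: "\<And>u v. (u, v) \<in> W \<Longrightarrow> 0 < u \<and> u \<le> k \<and> 0 < v \<and> v \<le> k \<and> coprime u v"
    and sep: "\<And>w w'. w \<in> W \<Longrightarrow> w' \<in> W \<Longrightarrow> \<forall>q\<in>P. exponents w q = exponents w' q \<Longrightarrow>
      exponents w = exponents w'"
  shows "card W \<le> Phi_tilde k (card P)"
proof -
  let ?S = "supported_upto k"
  let ?U = "\<Union>I\<in>Pow P. ?S I \<times> ?S (P - I)"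
  let ?f = "\<lambda>(u, v). (prime_part P u, prime_part P v)"
  have inj: "inj_on ?f W"
  proof (rule inj_onI, clarify)
    fix u v u' v'
    assume w: "(u, v) \<in> W" "(u', v') \<in> W" and eq: "prime_part P u = prime_part P u'" "prime_part P v = prime_part P v'"
    have "exponents (u, v) q = exponents (u', v') q" if "q \<in> P" for q
    proof -
      have q: "prime q" using that P by blast
      have "multiplicity q u = multiplicity q u'" "multiplicity q v = multiplicity q v'"
        using multiplicity_prime_part[OF P q] eq that by metis+
      then show ?thesis by (simp add: exponents_def)
    qed
    then have "exponents (u, v) = exponents (u', v')" using sep w by blast
    then show "u = u' \<and> v = v'" using exponents_inj[of u v u' v'] W w by blast
  qed
  have sub: "?f ` W \<subseteq> ?U"
  proof clarify
    fix u v assume w: "(u, v) \<in> W"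
    \<comment> \<open>Primes of \<open>P\<close> dividing neither number are put with the
      denominator. The sets for different \<open>I\<close> may overlap, which is harmless for an
      upper bound.\<close>
    define I where "I = {q\<in>P. q dvd u}"
    have dv: "q \<in> P \<and> q dvd n" if "prime q" "q dvd prime_part P n" "n > 0" for q n
    proof -
      have "multiplicity q (prime_part P n) \<noteq> 0"
        using that prime_part_pos[OF P, of n] by (simp add: prime_elem_multiplicity_eq_zero_iff)
      then show ?thesis using multiplicity_prime_part[OF P that(1), of n] that
        by (auto split: if_splits simp: not_dvd_imp_multiplicity_0 intro: ccontr)
    qed
    have "prime_part P u \<in> ?S I"
      using W[OF w] dv prime_part_pos[OF P] prime_part_le[OF P, of u] by (force simp: supported_upto_def I_def)
    moreover have "prime_part P v \<in> ?S (P - I)"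
    proof -
      have "\<not> q dvd u" if "q dvd v" "prime q" for q
        using that W[OF w] by (meson coprime_common_divisor not_prime_unit)
      then show ?thesis
        using W[OF w] dv prime_part_pos[OF P] prime_part_le[OF P, of v] by (force simp: supported_upto_def I_def)
    qed
    ultimately show "(prime_part P u, prime_part P v) \<in> ?U" by (auto simp: I_def)
  qed
  have "card W \<le> card ?U"
    using inj sub P(1) finite_supported_upto by (intro card_inj_on_le) auto
  also have "\<dots> \<le> (\<Sum>I\<in>Pow P. card (?S I \<times> ?S (P - I)))"
    using P(1) by (intro card_UN_le) auto
  also have "\<dots> \<le> (\<Sum>I\<in>Pow P. Psi_nth k (card I) * Psi_nth k (card P - card I))"
  proof (rule sum_mono)
    fix I assume I: "I \<in> Pow P"
    then have fI: "finite I" using P(1) finite_subset by blast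
    have "card (?S I) \<le> Psi_nth k (card I)"
      using I P fI by (intro card_supported_upto_le) auto
    moreover have "card (?S (P - I)) \<le> Psi_nth k (card (P - I))"
      using I P by (intro card_supported_upto_le) auto
    moreover have "card (P - I) = card P - card I" using I fI by (simp add: card_Diff_subset)
    ultimately show "card (?S I \<times> ?S (P - I)) \<le> Psi_nth k (card I) * Psi_nth k (card P - card I)"
      by (simp add: card_cartesian_product mult_le_mono)
  qed
  also have "\<dots> = Phi_tilde k (card P)"
    using sum_Pow_card[OF P(1), of "\<lambda>i. Psi_nth k i * Psi_nth k (card P - i)"]
    by (simp add: Phi_tilde_def mult.assoc)
  finally show ?thesis .
qed

section \<open>Heights and fractions modulo \<open>p\<close>\<close>

text \<open>If \<open>a\<close> represents one residue, then \<open>a\<close> or \<open>- a\<close>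
  represents the other, with the same absolute value. Hence the sign of a fraction does not affect
  the height.\<close>

lemma int_height_eq_if_cong:
  assumes "[x = y] (mod int p) \<or> [x = - y] (mod int p)"
  shows "int_height p x = int_height p y"
proof -
  have *: "(\<exists>a. [a = x] (mod int p) \<and> n = nat \<bar>a\<bar>) \<Longrightarrow> (\<exists>a. [a = y] (mod int p) \<and> n = nat \<bar>a\<bar>)"
    if "[x = y] (mod int p) \<or> [x = - y] (mod int p)" for x y n
  proof -
    assume "\<exists>a. [a = x] (mod int p) \<and> n = nat \<bar>a\<bar>"
    then obtain b where b: "[b = x] (mod int p)" "n = nat \<bar>b\<bar>" by blast
    have "[b = y] (mod int p) \<or> [- b = y] (mod int p)"
      using that b(1) cong_trans cong_minus_minus_iff by (metis minus_minus)
    then show ?thesis using b(2) by (metis abs_minus_cancel)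
  qed
  have "[y = x] (mod int p) \<or> [y = - x] (mod int p)"
    using assms by (metis cong_sym cong_minus_minus_iff minus_minus)
  then have "(\<exists>a. [a = x] (mod int p) \<and> n = nat \<bar>a\<bar>) \<longleftrightarrow> (\<exists>a. [a = y] (mod int p) \<and> n = nat \<bar>a\<bar>)" for n
    using * assms by blast
  then show ?thesis unfolding int_height_def by presburger
qed

text \<open>Take a pair attaining the rational height, split off the sign of \<open>a\<close> and
  divide by the gcd, which is positive and below \<open>p\<close> and so cancels in the
  congruence.\<close>

lemma rat_height_le_obtains_fraction:
  assumes p: "prime p" and k: "k < p" and x: "\<not> int p dvd x" and h: "rat_height p x \<le> k"
  obtains u v :: nat and \<sigma> :: int where "0 < u" "u \<le> k" "0 < v" "v \<le> k" "coprime u v" "\<sigma> \<in> {1, -1}"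
    "[\<sigma> * int u = int v * x] (mod int p)"
proof -
  \<comment> \<open>The pair \<open>a = x\<close>, \<open>b = 1\<close> is admissible, so the least
    value is attained.\<close>
  have "\<exists>a b. b > 0 \<and> [a = int b * x] (mod int p) \<and> rat_height p x = max (nat \<bar>a\<bar>) b"
    unfolding rat_height_def
    by (rule LeastI_ex) (use cong_refl[of x "int p"] in \<open>force intro: exI[of _ 1] exI[of _ x]\<close>)
  then obtain a b where ab: "b > 0" "[a = int b * x] (mod int p)" "rat_height p x = max (nat \<bar>a\<bar>) b"
    by blast
  have bk: "b \<le> k" "nat \<bar>a\<bar> \<le> k" using ab(3) h by auto
  have "\<not> int p dvd int b" using ab(1) bk k by (auto dest!: dvd_imp_le)
  then have "\<not> int p dvd int b * x" using x p by (simp add: prime_dvd_mult_iff)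
  then have "a \<noteq> 0" using ab(2) by (auto simp: cong_iff_dvd_diff)
  define g where "g = gcd (nat \<bar>a\<bar>) b"
  have g: "g > 0" using ab(1) by (simp add: g_def)
  obtain u v where uv: "nat \<bar>a\<bar> = u * g" "b = v * g" "coprime u v"
    using gcd_coprime_exists[of "nat \<bar>a\<bar>" b] g unfolding g_def by blast
  have pos: "u > 0" "v > 0" using uv(1,2) ab(1) \<open>a \<noteq> 0\<close> by (cases u; cases v; simp)+
  have le: "u \<le> k" "v \<le> k" "g \<le> k"
  proof -
    have "u \<le> u * g" "v \<le> v * g" "g \<le> v * g" using g pos by simp_all
    then show "u \<le> k" "v \<le> k" "g \<le> k" using bk uv(1,2) by linarith+
  qed
  have a: "a = int g * (sgn a * int u)"
  proof -
    have "\<bar>a\<bar> = int u * int g" using uv(1) by (metis abs_ge_zero int_nat_eq of_nat_mult)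
    then show ?thesis using mult_sgn_abs[of a] by (simp add: ac_simps)
  qed
  have "coprime (int g) (int p)"
  proof -
    have "\<not> p dvd g" using le(3) g k by (auto dest!: dvd_imp_le)
    then show ?thesis using p prime_imp_coprime[of p g] by (simp add: coprime_commute)
  qed
  moreover have "[int g * (sgn a * int u) = int g * (int v * x)] (mod int p)"
    using ab(2) a uv(2) by (simp add: ac_simps)
  ultimately have "[sgn a * int u = int v * x] (mod int p)"
    by (simp add: cong_mult_lcancel)
  moreover have "sgn a \<in> {1, -1}" using \<open>a \<noteq> 0\<close> by (auto simp: sgn_if)
  ultimately show ?thesis using that pos le uv(3) by blast
qed

section \<open>Products of \<open>r\<close> fractions in one coset\<close>

lemma prod_power_le_power_sum_list:
  fixes u :: "nat \<Rightarrow> nat"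
  assumes "\<And>i. i < length l \<Longrightarrow> u i \<le> k"
  shows "(\<Prod>i<length l. u i ^ (l ! i)) \<le> k ^ sum_list l"
proof -
  have "(\<Prod>i<length l. u i ^ (l ! i)) \<le> (\<Prod>i<length l. k ^ (l ! i))"
    using assms by (intro prod_mono) (auto intro: power_mono)
  also have "\<dots> = k ^ sum_list l"
    by (simp add: sum_list_sum_nth power_sum atLeast0LessThan)
  finally show ?thesis .
qed

text \<open>The products of \<open>r\<close> of the residues \<open>a * g i\<close> lie in one coset of \<open>G\<close>, and lift to fractions with
  numerator and denominator at most \<open>k ^ r\<close>; such fractions are determined up to sign by their
  residue, so independence of the exponents makes the products distinct.\<close>

lemma binomial_le_card_if_independent:
  fixes u v :: "nat \<Rightarrow> nat" and g \<sigma> :: "nat \<Rightarrow> int" and a :: int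
  assumes p: "2 * k ^ (2 * r) < p"
    and G: "finite G" "1 \<in> G" "\<And>x y. x \<in> G \<Longrightarrow> y \<in> G \<Longrightarrow> x * y mod int p \<in> G"
    and uv: "\<And>i. i < m \<Longrightarrow> 0 < u i \<and> u i \<le> k \<and> 0 < v i \<and> v i \<le> k"
    and g: "\<And>i. i < m \<Longrightarrow> g i \<in> G" and \<sigma>: "\<And>i. i < m \<Longrightarrow> \<sigma> i \<in> {1, -1}"
    and cong: "\<And>i. i < m \<Longrightarrow> [\<sigma> i * int (u i) = int (v i) * (a * g i)] (mod int p)"
    and inj: "inj_on (\<lambda>i. exponents (u i, v i)) {..<m}"
    and ind: "fun_space.independent ((\<lambda>i. exponents (u i, v i)) ` {..<m})"
    and p1: "p > 1"
  shows "(r + m - 1) choose r \<le> card G"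
proof -
  \<comment> \<open>The entry \<open>l ! i\<close> says how often the \<open>i\<close>-th fraction
    is used: \<open>?L\<close> encodes the multisets of \<open>r\<close> indices, counted by stars
    and bars.\<close>
  let ?L = "{l::nat list. length l = m \<and> sum_list l = r}"
  define U where "U l = (\<Prod>i<m. u i ^ (l ! i))" for l
  define V where "V l = (\<Prod>i<m. v i ^ (l ! i))" for l
  define Y where "Y l = (\<Prod>i<m. g i ^ (l ! i))" for l
  define S where "S l = (\<Prod>i<m. \<sigma> i ^ (l ! i))" for l
  have pow_G: "x ^ n mod int p \<in> G" if "x \<in> G" for x n
  proof (induction n)
    case 0
    show ?case using G(2) p1 by simp
  next
    case (Suc n)
    then show ?case using G(3)[OF that Suc] by (simp add: mod_mult_right_eq)
  qed
  have Y_G: "Y l mod int p \<in> G" for l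
  proof -
    have "(\<Prod>i<n. g i ^ (l ! i)) mod int p \<in> G" if "n \<le> m" for n
      using that
    proof (induction n)
      case 0
      show ?case using G(2) p1 by simp
    next
      case (Suc n)
      then show ?case
        using G(3)[of "(\<Prod>i<n. g i ^ (l ! i)) mod int p" "g n ^ (l ! n) mod int p"] pow_G[OF g[of n]]
        by (simp add: mod_mult_eq mult.commute)
    qed
    then show ?thesis by (simp add: Y_def)
  qed
  have S_abs: "\<bar>S l\<bar> = 1" for l
  proof -
    have "\<bar>\<sigma> i\<bar> ^ n = 1" if "i < m" for i n
    proof -
      have "\<bar>\<sigma> i\<bar> = 1" using \<sigma>[OF that] by auto
      then show ?thesis by simp
    qed
    then show ?thesis by (simp add: S_def abs_prod power_abs)
  qed
  have UV_cong: "[S l * int (U l) = int (V l) * (a ^ r * Y l)] (mod int p)" if "l \<in> ?L" for l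
  proof -
    have "[(\<Prod>i<m. (\<sigma> i * int (u i)) ^ (l ! i)) = (\<Prod>i<m. (int (v i) * (a * g i)) ^ (l ! i))] (mod int p)"
      by (intro cong_prod cong_pow cong) auto
    \<comment> \<open>The exponents add up to \<open>r\<close>, so all products share the factor
      \<open>a ^ r\<close> and lie in the same coset.\<close>
    moreover have "(\<Prod>i<m. a ^ (l ! i)) = a ^ r"
      using that by (auto simp: sum_list_sum_nth power_sum atLeast0LessThan)
    ultimately show ?thesis
      by (simp add: S_def U_def V_def Y_def power_mult_distrib prod.distrib)
  qed
  have U_le: "U l \<le> k ^ r" and V_le: "V l \<le> k ^ r" if "l \<in> ?L" for l
    using that uv prod_power_le_power_sum_list[of l u k] prod_power_le_power_sum_list[of l v k]
    by (auto simp: U_def V_def)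
  have pos: "U l > 0" "V l > 0" for l
    using uv by (auto simp: U_def V_def intro!: prod_pos)
  have "inj_on (\<lambda>l. Y l mod int p) ?L"
  proof (rule inj_onI)
    fix l l' assume l: "l \<in> ?L" "l' \<in> ?L" and "Y l mod int p = Y l' mod int p"
    then have Y: "[Y l = Y l'] (mod int p)" by (simp add: cong_def)
    have "[S l * int (U l) * int (V l') = int (V l) * (a ^ r * Y l) * int (V l')] (mod int p)"
      by (intro cong_mult UV_cong l cong_refl)
    also have "[int (V l) * (a ^ r * Y l) * int (V l') = int (V l) * (a ^ r * Y l') * int (V l')] (mod int p)"
      by (intro cong_mult Y cong_refl)
    also have "int (V l) * (a ^ r * Y l') * int (V l') = int (V l) * (int (V l') * (a ^ r * Y l'))"
      by (simp add: ac_simps)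
    also have "[int (V l) * (int (V l') * (a ^ r * Y l')) = int (V l) * (S l' * int (U l'))] (mod int p)"
      by (intro cong_mult cong_refl cong_sym[OF UV_cong] l)
    finally have "[S l * int (U l * V l') = S l' * int (U l' * V l)] (mod int p)"
      by (simp add: ac_simps)
    then have dvd: "int p dvd S l * int (U l * V l') - S l' * int (U l' * V l)"
      by (simp add: cong_iff_dvd_diff)
    \<comment> \<open>This multiple of \<open>p\<close> is smaller than \<open>p\<close> in absolute
      value, so it vanishes: the congruence lifts to an equality of integers.\<close>
    have "\<bar>S l * int (U l * V l') - S l' * int (U l' * V l)\<bar> \<le> int (U l * V l') + int (U l' * V l)"
      using abs_triangle_ineq4[of "S l * int (U l * V l')" "S l' * int (U l' * V l)"]
      by (simp add: abs_mult S_abs)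
    also have "\<dots> \<le> int (k ^ r * k ^ r) + int (k ^ r * k ^ r)"
      by (intro add_mono of_nat_mono mult_le_mono U_le V_le l)
    also have "\<dots> = int (2 * k ^ (2 * r))" by (simp add: mult_2[of r] power_add)
    also have "\<dots> < int p" using p by (simp only: of_nat_less_iff)
    finally have "S l * int (U l * V l') - S l' * int (U l' * V l) = 0"
      using dvd dvd_imp_le_int[of "S l * int (U l * V l') - S l' * int (U l' * V l)" "int p"] by linarith
    then have "\<bar>S l * int (U l * V l')\<bar> = \<bar>S l' * int (U l' * V l)\<bar>" by simp
    then have UV: "U l * V l' = U l' * V l"
      by (simp only: abs_mult S_abs abs_of_nat mult_1 of_nat_eq_iff)
    have mult_prod: "multiplicity q (\<Prod>i<m. z i ^ (j ! i)) = (\<Sum>i<m. j ! i * multiplicity q (z i))"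
      if "prime q" "\<And>i. i < m \<Longrightarrow> z i > 0" for q j and z :: "nat \<Rightarrow> nat"
    proof -
      have "multiplicity q (\<Prod>i<m. z i ^ (j ! i)) = (\<Sum>i<m. multiplicity q (z i ^ (j ! i)))"
        using that by (intro prime_elem_multiplicity_prod_distrib) (auto dest: that(2))
      also have "\<dots> = (\<Sum>i<m. j ! i * multiplicity q (z i))"
        using that by (intro sum.cong refl prime_elem_multiplicity_power_distrib) (auto dest: that(2))
      finally show ?thesis .
    qed
    have multU: "multiplicity q (U j) = (\<Sum>i<m. j ! i * multiplicity q (u i))"
      and multV: "multiplicity q (V j) = (\<Sum>i<m. j ! i * multiplicity q (v i))" if "prime q" for q j
      unfolding U_def V_def using that uv by (intro mult_prod; blast)+
    \<comment> \<open>Multiplicities turn the equality of products into an equality of combinations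
      of exponent vectors.\<close>
    have "(\<Sum>i<m. of_nat (l ! i) * exponents (u i, v i) q) = (\<Sum>i<m. of_nat (l' ! i) * exponents (u i, v i) q)" for q
    proof (cases "prime q")
      case True
      have "multiplicity q (U l) + multiplicity q (V l') = multiplicity q (U l') + multiplicity q (V l)"
        using arg_cong[OF UV, of "multiplicity q"] True pos
        by (simp add: prime_elem_multiplicity_mult_distrib)
      then have "rat_of_nat (multiplicity q (U l)) + of_nat (multiplicity q (V l'))
          = of_nat (multiplicity q (U l')) + of_nat (multiplicity q (V l))"
        by (metis of_nat_add)
      then show ?thesis
        using True by (simp add: multU multV exponents_def algebra_simps sum_subtractf)
    qed (simp add: exponents_def)
    then have "rat_of_nat (l ! i) = of_nat (l' ! i)" if "i < m" for i
      using fun_space_independent_coeffs_eq[OF ind inj, of "\<lambda>i. of_nat (l ! i)" "\<lambda>i. of_nat (l' ! i)" i] that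
      by blast
    then show "l = l'" using l by (intro nth_equalityI) auto
  qed
  then have "card ?L \<le> card G" using Y_G G(1) by (intro card_inj_on_le) auto
  then show ?thesis by (simp add: card_length_sum_list)
qed

section \<open>Size of \<open>k ^ (2 * r)\<close> and the subgroup of order \<open>t\<close>\<close>

text \<open>The floor in \<open>r1\<close> gives \<open>2 * r1 p k * ln k\<close> \<le>
  \<open>ln (p / 2)\<close>; exponentiate. Strictness is obtained later from the parity of
  \<open>p\<close>.\<close>

lemma power_r1_le:
  assumes "1 < k" "real k \<le> sqrt (real p / 2)"
  shows "2 * k ^ (2 * r1 p k) \<le> p"
proof -
  let ?x = "ln (real p / 2) / (2 * ln (real k))"
  have "0 < sqrt (real p / 2)" using assms by linarith
  then have pos: "real p / 2 > 0" by simp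
  have lnk: "ln (real k) > 0" using assms(1) by simp
  \<comment> \<open>By \<open>r1_ge_1\<close> the floor is positive, so \<open>nat\<close> truncates
    nothing.\<close>
  have "real (r1 p k) \<le> ?x" using r1_ge_1[OF assms] unfolding r1_def by linarith
  then have "real (2 * r1 p k) * ln (real k) \<le> ln (real p / 2)"
    using lnk by (simp add: field_simps)
  then have "ln (real k ^ (2 * r1 p k)) \<le> ln (real p / 2)"
    using assms(1) by (simp add: ln_realpow)
  then have "real k ^ (2 * r1 p k) \<le> real p / 2"
    using assms(1) pos by (subst (asm) ln_le_cancel_iff) auto
  then have "real (2 * k ^ (2 * r1 p k)) \<le> real p" by simp
  then show ?thesis by (simp only: of_nat_le_iff)
qed

theorem theorem1p5:
  fixes p t k :: nat and a :: int
  assumes "prime p" and "p > 2"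
    and "t > 0" and "t dvd p - 1"
    and "1 < k" and "real k \<le> sqrt (real p / 2)"
    and "a \<in> Units (Fp p)"
  shows "card (int_height p ` V p k t a) \<le> Phi_tilde k (s1 p k t + 1)"
proof -
  interpret residues_prime p "Fp p"
    by unfold_locales (use assms in auto)
  define r where "r = r1 p k"
  define d where "d = s1 p k t + 1"
  define G where "G = subgrp p t"
  have G: "subgroup G (units_of (Fp p))" "card G = t"
    using theI'[OF ex1_subgroup_of_order[OF assms(1,4,3)]] unfolding G_def subgrp_def by auto
  have G_units: "G \<subseteq> {1..int (p - 1)}"
    using subgroup.subset[OF G(1)] res_prime_units_eq by (simp add: units_of_def)
  have a: "a \<in> {1..int (p - 1)}" using assms(7) res_prime_units_eq by simp
  have "finite G" using G(2) assms(3) by (simp add: card_ge_0_finite)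
  moreover have "1 \<in> G"
    using subgroup.one_closed[OF G(1)] by (simp add: units_of_def res_one_eq)
  moreover have "x * y mod int p \<in> G" if "x \<in> G" "y \<in> G" for x y
    using subgroup.m_closed[OF G(1) that] by (simp add: units_of_def res_mult_eq)
  ultimately have G_props: "finite G" "1 \<in> G" "\<And>x y. x \<in> G \<Longrightarrow> y \<in> G \<Longrightarrow> x * y mod int p \<in> G"
    by blast+
  have kr: "2 * k ^ (2 * r) < p"
  proof -
    \<comment> \<open>An odd \<open>p\<close> excludes equality; lifting congruences to equalities
      uses the strict bound.\<close>
    have "2 * k ^ (2 * r) \<noteq> p" using prime_odd_nat[OF assms(1,2)] by (metis dvd_triv_left)
    then show ?thesis using power_r1_le[OF assms(5,6)] by (simp add: r_def)
  qed
  have "k ^ 1 \<le> k ^ (2 * r)"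
    using assms(5) r1_ge_1[OF assms(5,6)] by (intro power_increasing) (auto simp: r_def)
  then have kp: "k < p" using kr by simp

  \<comment> \<open>From heights in the coset to reduced fractions\<close>
  define rep where "rep w \<sigma> g \<longleftrightarrow> \<sigma> \<in> {1, -1} \<and> g \<in> G \<and>
    [\<sigma> * int (fst w) = int (snd w) * (a * g)] (mod int p)" for w :: "nat \<times> nat" and \<sigma> g
  define W where "W = {w. 0 < fst w \<and> fst w \<le> k \<and> 0 < snd w \<and> snd w \<le> k \<and>
    coprime (fst w) (snd w) \<and> (\<exists>\<sigma> g. rep w \<sigma> g)}"
  have finW: "finite W"
    by (rule finite_subset[of _ "{..k} \<times> {..k}"]) (auto simp: W_def)

  have V: "\<exists>w\<in>W. \<exists>\<sigma> g. rep w \<sigma> g \<and> x = a * g mod int p" if x: "x \<in> V p k t a" for x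
  proof -
    obtain g where g: "g \<in> G" "x = a * g mod int p" and h: "rat_height p x \<le> k"
      using x by (auto simp: V_def l_coset_def res_mult_eq G_def)
    have "\<not> int p dvd a" "\<not> int p dvd g"
      using a g(1) G_units by (auto dest!: zdvd_imp_le)
    then have "\<not> int p dvd x" using g(2) assms(1) by (simp add: dvd_mod_iff prime_dvd_mult_iff)
    then obtain u v \<sigma> where uv: "0 < u" "u \<le> k" "0 < v" "v \<le> k" "coprime u v" "\<sigma> \<in> {1, -1}"
        "[\<sigma> * int u = int v * x] (mod int p)"
      using rat_height_le_obtains_fraction[OF assms(1) kp _ h] by metis
    have "[int v * x = int v * (a * g)] (mod int p)"
      using g(2) by (simp add: cong_def mod_mult_right_eq)
    then have "rep (u, v) \<sigma> g" using uv(6,7) g(1) cong_trans by (simp add: rep_def) blast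
    then show ?thesis using uv g(2) by (intro bexI[of _ "(u, v)"]) (auto simp: W_def)
  qed
  \<comment> \<open>A fraction may represent two elements of the coset that differ in sign, as can
    happen when -1 lies in the subgroup; it still determines the integer height.\<close>
  have same_height: "int_height p (a * g mod int p) = int_height p (a * g' mod int p)"
    if w: "w \<in> W" "rep w \<sigma> g" "rep w \<sigma>' g'" for w \<sigma> g \<sigma>' g'
  proof -
    have "\<not> p dvd snd w" using w(1) kp by (auto simp: W_def dest!: dvd_imp_le)
    then have cop: "coprime (int (snd w)) (int p)"
      using assms(1) prime_imp_coprime[of p "snd w"] by (simp add: coprime_commute)
    have c: "[int (snd w) * (a * g) = \<sigma> * int (fst w)] (mod int p)"
        "[\<sigma>' * int (fst w) = int (snd w) * (a * g')] (mod int p)"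
      using w by (auto simp: rep_def cong_sym)
    consider "\<sigma> = \<sigma>'" | "\<sigma> = - \<sigma>'" using w by (auto simp: rep_def)
    then have "[a * g = a * g'] (mod int p) \<or> [a * g = - (a * g')] (mod int p)"
    proof cases
      case 1
      then have "[int (snd w) * (a * g) = int (snd w) * (a * g')] (mod int p)"
        using c cong_trans by blast
      then show ?thesis using cop cong_mult_lcancel by blast
    next
      case 2
      have "[- (\<sigma>' * int (fst w)) = - (int (snd w) * (a * g'))] (mod int p)"
        using c(2) by (simp only: cong_minus_minus_iff)
      then have "[int (snd w) * (a * g) = int (snd w) * (- (a * g'))] (mod int p)"
        using c(1) 2 cong_trans by fastforce
      then show ?thesis using cop cong_mult_lcancel by blast
    qed
    then have "int_height p (a * g) = int_height p (a * g')" by (rule int_height_eq_if_cong)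
    moreover have "int_height p (z mod int p) = int_height p z" for z
      by (rule int_height_eq_if_cong) simp
    ultimately show ?thesis by simp
  qed
  define f where "f w = int_height p (a * (SOME g. \<exists>\<sigma>. rep w \<sigma> g) mod int p)" for w
  have "int_height p ` V p k t a \<subseteq> f ` W"
  proof clarify
    fix x assume "x \<in> V p k t a"
    then obtain w \<sigma> g where w: "w \<in> W" "rep w \<sigma> g" "x = a * g mod int p" using V by blast
    then have "\<exists>\<sigma>. rep w \<sigma> (SOME g. \<exists>\<sigma>. rep w \<sigma> g)" by (metis (mono_tags, lifting) someI_ex)
    then have "int_height p x = f w" using same_height w unfolding f_def by blast
    then show "int_height p x \<in> f ` W" using w by blast
  qed
  then have "card (int_height p ` V p k t a) \<le> card W"
    using finW by (meson card_image_le card_mono finite_imageI le_trans)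

  \<comment> \<open>Dimension of the span and choice of the primes\<close>
  also have "card W \<le> Phi_tilde k d"
  proof -
    \<comment> \<open>Choosing the basis among the vectors themselves attaches a fraction and a
      coset element to each basis vector.\<close>
    obtain B where B: "B \<subseteq> exponents ` W" "fun_space.independent B" "exponents ` W \<subseteq> fun_space.span B"
      using fun_space.maximal_independent_subset by blast
    have finB: "finite B" using B(1) finW finite_subset by blast
    have "card B \<le> d"
    proof (rule ccontr)
      assume "\<not> card B \<le> d"
      then obtain C where C: "C \<subseteq> B" "card C = d + 1" "finite C"
        using obtain_subset_with_card_n[of "d + 1" B] by auto
      obtain c where c: "bij_betw c {..<d + 1} C"
        using ex_bij_betw_nat_finite[OF C(3)] C(2) by (auto simp: atLeast0LessThan)
      have "\<exists>w. w \<in> W \<and> exponents w = c i" if "i < d + 1" for i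
      proof -
        have "c i \<in> exponents ` W" using bij_betwE[OF c] C(1) B(1) that by auto
        then show ?thesis by (metis imageE)
      qed
      then obtain w where w: "\<And>i. i < d + 1 \<Longrightarrow> w i \<in> W \<and> exponents (w i) = c i"
        by metis
      then have "\<exists>\<sigma> g. rep (w i) \<sigma> g" if "i < d + 1" for i using that by (auto simp: W_def)
      then obtain \<sigma> g where rep: "\<And>i. i < d + 1 \<Longrightarrow> rep (w i) (\<sigma> i) (g i)"
        by metis
      have E: "exponents (fst (w i), snd (w i)) = c i" if "i < d + 1" for i using w[OF that] by simp
      have "(r + (d + 1) - 1) choose r \<le> card G"
      proof (rule binomial_le_card_if_independent[OF kr G_props, where u = "\<lambda>i. fst (w i)" and
            v = "\<lambda>i. snd (w i)" and g = g and \<sigma> = \<sigma> and a = a])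
        show "inj_on (\<lambda>i. exponents (fst (w i), snd (w i))) {..<d + 1}"
          using c E by (simp add: bij_betw_def inj_on_def)
        have "(\<lambda>i. exponents (fst (w i), snd (w i))) ` {..<d + 1} = C"
          using c E by (simp add: bij_betw_def)
        then show "fun_space.independent ((\<lambda>i. exponents (fst (w i), snd (w i))) ` {..<d + 1})"
          using fun_space.independent_mono[OF B(2) C(1)] by simp
      qed (use w rep assms(2) in \<open>auto simp: W_def rep_def\<close>)
      \<comment> \<open>By symmetry of the binomial coefficient, \<open>d\<close> would belong to
        the set whose maximum is \<open>s1 p k t = d - 1\<close>.\<close>
      then have "(r1 p k + d) choose d \<le> t"
        using G(2) binomial_symmetric[of r "r + d"] by (simp add: r_def)
      then have "d \<le> s1 p k t"
        unfolding s1_def using s1_set[OF assms(5,6,3)] by (intro Max_ge) auto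
      then show False by (simp add: d_def)
    qed
    obtain P where P: "finite P" "card P \<le> card B" "\<forall>q\<in>P. \<exists>f\<in>fun_space.span B. f q \<noteq> 0"
      and ker: "\<And>f. f \<in> fun_space.span B \<Longrightarrow> \<forall>q\<in>P. f q = 0 \<Longrightarrow> f = 0"
      using fun_space_separating_coordinates[OF finB] by blast
    have zero: "f q = 0" if "f \<in> fun_space.span B" "\<not> prime q" for f q
      using that(1)
    proof (induction rule: fun_space.span_induct_alt)
      case (step c x y)
      then obtain w where "x = exponents w" using B(1) by blast
      then show ?case using step that(2) by (simp add: exponents_def)
    qed simp
    have P_prime: "P \<subseteq> {q. prime q}" using P(3) zero by blast
    \<comment> \<open>The bound is wanted at \<open>d\<close> exactly, so \<open>P\<close> is padded
      with further primes; extra coordinates keep it separating.\<close>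
    obtain Q where Q: "Q \<subseteq> {q. prime q} - P" "finite Q" "card Q = d - card P"
      using infinite_arbitrarily_large[of "{q. prime q} - P" "d - card P"] P(1) primes_infinite by auto
    have "card (P \<union> Q) = d"
      using P(1,2) Q \<open>card B \<le> d\<close> by (subst card_Un_disjoint) auto
    moreover have "card W \<le> Phi_tilde k (card (P \<union> Q))"
    proof (rule card_le_Phi_tilde_if_separated)
      fix w w' assume w: "w \<in> W" "w' \<in> W" "\<forall>q\<in>P \<union> Q. exponents w q = exponents w' q"
      have "exponents w - exponents w' = 0"
        using w B(3) by (intro ker fun_space.span_diff) auto
      then show "exponents w = exponents w'" by simp
    qed (use P Q P_prime in \<open>auto simp: W_def\<close>)
    ultimately show ?thesis by simp
  qed
  finally show ?thesis by (simp add: d_def)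
qed

end
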